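(* Let $n\geq 3$ be an odd integer and let $G=C_{2n}(2,n)$. Then $G$ is levelable if and only if $n\in\{3,5\}$.
   Context: For $m\geq 2$ and $S\subseteq\{1,\ldots,\lfloor m/2\rfloor\}$, the circulant graph $C_m(S)$ is the graph on the vertex set $\{x_1,\ldots,x_m\}$ such that $\{x_i,x_j\}$ ($i\ne j$) is an edge precisely when $|i-j|\in S$ or $m-|i-j|\in S$. One writes $C_m(a,b)$ for $C_m(\{a,b\})$. A finite simple graph $G$ on $\{x_1,\ldots,x_m\}$ is levelable if there exist positive integers $c_1,\ldots,c_m$ and a constant $c$ such that $\sum_{x_i\in W}c_i=c$ for every maximal (under inclusion) independent set $W$ of $G$. *)

theory Defs
  imports Main
begin

record 'a graph =
  vertices :: "'a set"
  edges :: "'a set set"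

definition finite_simple_graph :: "'a graph \<Rightarrow> bool" where
  "finite_simple_graph G \<longleftrightarrow>
     finite (vertices G) \<and> (\<forall>e\<in>edges G. e \<subseteq> vertices G \<and> card e = 2)"

definition independent_set :: "'a graph \<Rightarrow> 'a set \<Rightarrow> bool" where
  "independent_set G W \<longleftrightarrow>
     W \<subseteq> vertices G \<and> (\<forall>u\<in>W. \<forall>v\<in>W. {u, v} \<notin> edges G)"

definition maximal_independent_set :: "'a graph \<Rightarrow> 'a set \<Rightarrow> bool" where
  "maximal_independent_set G W \<longleftrightarrow>
     independent_set G W \<and> (\<forall>W'. independent_set G W' \<and> W \<subseteq> W' \<longrightarrow> W' = W)"

(* Meant for graphs satisfying finite_simple_graph. *)
definition levelable :: "'a graph \<Rightarrow> bool" where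
  "levelable G \<longleftrightarrow>
     (\<exists>(c :: 'a \<Rightarrow> int) (k :: int). (\<forall>v\<in>vertices G. c v > 0) \<and>
        (\<forall>W. maximal_independent_set G W \<longrightarrow> (\<Sum>v\<in>W. c v) = k))"

(* The vertex x_i is represented by its index i. Meant for m \<ge> 2 and S \<subseteq> {1..m div 2}.
   The outer subtraction on nat does not truncate, as |i - j| < m on the vertex set. *)
definition circulant_graph :: "nat \<Rightarrow> nat set \<Rightarrow> nat graph" where
  "circulant_graph m S =
     \<lparr> vertices = {1..m},
       edges = {{i, j} | i j. i \<in> {1..m} \<and> j \<in> {1..m} \<and> i \<noteq> j \<and>
          (nat \<bar>int i - int j\<bar> \<in> S \<or> m - nat \<bar>int i - int j\<bar> \<in> S)} \<rparr>"

lemma finite_simple_graph_circulant_graph: "finite_simple_graph (circulant_graph m S)"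
  by (auto simp: finite_simple_graph_def circulant_graph_def)

lemma edge_circulant_graph_iff:
  assumes "i \<in> {1..m}" "j \<in> {1..m}" "i \<noteq> j"
  shows "{i, j} \<in> edges (circulant_graph m S) \<longleftrightarrow>
    nat \<bar>int i - int j\<bar> \<in> S \<or> m - nat \<bar>int i - int j\<bar> \<in> S"
  using assms by (auto simp: circulant_graph_def doubleton_eq_iff abs_minus_commute)

end

theory Submission
  imports Defs
begin

text \<open>
  Summing a levelling weight over all rotations of a maximal independent set \<open>W\<close> of a circulant
  graph gives \<open>m k = |W| C\<close>, where \<open>C\<close> is the total weight. Hence a circulant graph is levelable
  iff all its maximal independent sets have the same size. For odd \<open>n\<close> the graph
  \<open>C\<^bsub>2n\<^esub>(2,n)\<close> is the prism over the \<open>n\<close>-cycle, with columns \<open>{2k, 2k + n}\<close>. Its maximal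
  independent sets alternate between the two rows and skip an odd number of pairwise
  non-adjacent columns, so they all have size \<open>n - 1\<close> if \<open>n \<le> 5\<close>, while for \<open>n \<ge> 7\<close> one can skip
  one or three columns.
\<close>

section \<open>Levelable circulant graphs\<close>

text \<open>Here \<open>f\<close> is an automorphism, later a rotation. Maximality is pulled back:
  the preimage \<open>?U\<close> of an independent set above the image is independent and contains
  \<open>W\<close>, hence equals it.\<close>

lemma maximal_independent_set_image:
  assumes f: "bij_betw f (vertices G) (vertices G)"
    and e: "\<And>i j. i \<in> vertices G \<Longrightarrow> j \<in> vertices G \<Longrightarrow> {f i, f j} \<in> edges G \<longleftrightarrow> {i, j} \<in> edges G"
    and W: "maximal_independent_set G W"
  shows "maximal_independent_set G (f ` W)"
  unfolding maximal_independent_set_def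
proof (intro conjI allI impI)
  have WV: "W \<subseteq> vertices G" and ind: "\<forall>u\<in>W. \<forall>v\<in>W. {u, v} \<notin> edges G"
    using W by (auto simp: maximal_independent_set_def independent_set_def)
  have fV: "f ` vertices G = vertices G"
    using f by (simp add: bij_betw_def)
  show "independent_set G (f ` W)"
    unfolding independent_set_def using WV ind e fV by blast
  fix W' assume W': "independent_set G W' \<and> f ` W \<subseteq> W'"
  let ?U = "{x \<in> vertices G. f x \<in> W'}"
  have "independent_set G ?U"
    using W' e unfolding independent_set_def by blast
  moreover have "W \<subseteq> ?U" using W' WV by blast
  ultimately have "?U = W" using W by (auto simp: maximal_independent_set_def)
  moreover have "W' \<subseteq> f ` vertices G"
    using W' fV unfolding independent_set_def by simp
  then have "f ` ?U = W'" by blast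
  ultimately show "W' = f ` W" by simp
qed

text \<open>Since there are no loops, a vertex without neighbours in \<open>W\<close> could be added
  to \<open>W\<close>. This replaces the quantification over larger sets by a condition on single
  vertices.\<close>

lemma maximal_independent_set_iff:
  assumes "finite_simple_graph G"
  shows "maximal_independent_set G W \<longleftrightarrow>
    W \<subseteq> vertices G \<and> (\<forall>v\<in>vertices G. v \<in> W \<longleftrightarrow> (\<forall>w\<in>W. {v, w} \<notin> edges G))"
    (is "?L \<longleftrightarrow> ?R")
proof
  have "\<forall>e\<in>edges G. e \<subseteq> vertices G \<and> card e = 2"
    using assms unfolding finite_simple_graph_def by (rule conjunct2)
  then have loop: "{v} \<notin> edges G" for v
    by (auto dest: bspec[where x = "{v}"])
  assume L: ?L
  then have I: "independent_set G W" by (simp add: maximal_independent_set_def)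
  have "v \<in> W" if "v \<in> vertices G" "\<forall>w\<in>W. {v, w} \<notin> edges G" for v
  proof -
    have "independent_set G (insert v W)"
      using I that loop by (auto simp: independent_set_def insert_commute)
    then show ?thesis using L by (auto simp: maximal_independent_set_def)
  qed
  then show ?R using I by (auto simp: independent_set_def)
next
  assume R: ?R
  then have "independent_set G W" by (auto simp: independent_set_def)
  moreover have "W' = W" if "independent_set G W'" "W \<subseteq> W'" for W'
    using that R unfolding independent_set_def by blast
  ultimately show ?L by (auto simp: maximal_independent_set_def)
qed

section \<open>Rotations of circulant graphs\<close>

lemma vertices_circulant_graph [simp]: "vertices (circulant_graph m S) = {1..m}"
  by (simp add: circulant_graph_def)

text \<open>The vertex is fixed and the rotation varies: over all \<open>m\<close> rotations it
  visits every vertex once. \<open>Suc\<close> turns residues into labels, so \<open>v\<close>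
  stands for a rotation by v + 1 steps.\<close>

lemma bij_betw_Suc_add_mod:
  assumes "m > 0"
  shows "bij_betw (\<lambda>v. Suc ((x + v) mod m)) {..<m} {1..m}"
proof -
  have "inj_on (\<lambda>v. Suc ((x + v) mod m)) {..<m}"
  proof (rule inj_onI)
    fix u v assume uv: "u \<in> {..<m}" "v \<in> {..<m}"
      and "Suc ((x + u) mod m) = Suc ((x + v) mod m)"
    then have "(int x + int u) mod int m = (int x + int v) mod int m"
      by (metis Suc_inject of_nat_add of_nat_mod)
    then have "int u mod int m = int v mod int m"
      by (metis add_diff_cancel_left' mod_diff_left_eq)
    then show "u = v" using uv by simp
  qed
  moreover have "(\<lambda>v. Suc ((x + v) mod m)) ` {..<m} \<subseteq> {1..m}"
    using assms by (auto simp: Suc_le_eq)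
  ultimately show ?thesis
    by (simp add: bij_betw_def card_image card_subset_eq)
qed

lemma bij_betw_rotation:
  assumes "m > 0"
  shows "bij_betw (\<lambda>i. Suc ((i + v) mod m)) {1..m} {1..m}"
proof -
  have "bij_betw (\<lambda>i. i - 1) {1..m} {..<m}"
    by (rule bij_betw_byWitness[where f' = Suc]) auto
  \<comment> \<open>\<open>Suc v + (i - 1)\<close> is \<open>i + v\<close>, so the offset absorbs
    the shift to zero-based indices.\<close>
  from bij_betw_trans[OF this bij_betw_Suc_add_mod[OF assms, of "Suc v"]]
  show ?thesis
    by (rule bij_betw_cong[THEN iffD1, rotated]) (auto simp: add.commute)
qed

text \<open>A rotation keeps the distance \<open>d\<close> of the endpoints or, when the wrap-around
  falls between them, turns it into \<open>m - d\<close>. The edge condition is symmetric under this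
  exchange.\<close>

lemma edge_rotation_iff:
  assumes i: "i \<in> {1..m}" and j: "j \<in> {1..m}"
  shows "{Suc ((i + v) mod m), Suc ((j + v) mod m)} \<in> edges (circulant_graph m S) \<longleftrightarrow>
    {i, j} \<in> edges (circulant_graph m S)"
  using i j
proof (induction i j rule: linorder_wlog)
  case (le i j)
  show ?case
  proof (cases "i = j")
    case True
    then show ?thesis
      by (auto simp: circulant_graph_def doubleton_eq_iff)
  next
    case False
    define d where "d = j - i"
    define a where "a = (i + v) mod m"
    have m: "m > 0" and d: "0 < d" "d < m" "j = i + d"
      using le False by (auto simp: d_def)
    have a: "a < m" using m by (simp add: a_def)
    have "(j + v) mod m = (a + d) mod m"
      unfolding a_def d(3) by (simp add: mod_add_left_eq mod_add_right_eq add_ac)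
    also have "\<dots> = (if a + d < m then a + d else a + d - m)"
      using a d by (simp add: mod_if)
    finally have b: "(j + v) mod m = (if a + d < m then a + d else a + d - m)" .
    show ?thesis
      unfolding b a_def[symmetric] using a d le
      by (subst (1 2) edge_circulant_graph_iff) (auto simp: nat_diff_distrib)
  qed
next
  case (sym i j)
  then show ?case by (simp add: insert_commute)
qed

theorem levelable_circulant_graph_iff:
  assumes m: "m > 0"
  shows "levelable (circulant_graph m S) \<longleftrightarrow>
    (\<exists>k. \<forall>W. maximal_independent_set (circulant_graph m S) W \<longrightarrow> card W = k)"
    (is "levelable ?G \<longleftrightarrow> ?R")
proof
  assume "levelable ?G"
  then obtain c :: "nat \<Rightarrow> int" and k where
    pos: "\<And>v. v \<in> {1..m} \<Longrightarrow> c v > 0" and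
    sum: "\<And>W. maximal_independent_set ?G W \<Longrightarrow> sum c W = k"
    unfolding levelable_def vertices_circulant_graph by metis
  define C where "C = sum c {1..m}"
  have C: "C > 0" unfolding C_def using m pos by (intro sum_pos) auto
  \<comment> \<open>The right-hand side does not mention \<open>W\<close>; it comes from dividing
    the double count by \<open>C > 0\<close>.\<close>
  have "int (card W) = int m * k div C" if W: "maximal_independent_set ?G W" for W
  proof -
    let ?r = "\<lambda>v i. Suc ((i + v) mod m)"
    have WV: "W \<subseteq> {1..m}"
      using W by (auto simp: maximal_independent_set_def independent_set_def)
    have "(\<Sum>i\<in>W. c (?r v i)) = k" for v
    proof -
      have "inj_on (?r v) W"
        using bij_betw_rotation[OF m] WV by (meson bij_betw_def inj_on_subset)
      then have "(\<Sum>i\<in>W. c (?r v i)) = sum c (?r v ` W)"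
        by (simp add: sum.reindex)
      also have "\<dots> = k"
        using bij_betw_rotation[OF m] edge_rotation_iff W
        by (intro sum maximal_independent_set_image) auto
      finally show ?thesis .
    qed
    \<comment> \<open>Double count over rotations and members of \<open>W\<close>: each rotated set
      weighs \<open>k\<close>, while each member runs through all vertices and contributes
      \<open>C\<close>.\<close>
    then have "int m * k = (\<Sum>v<m. \<Sum>i\<in>W. c (?r v i))" by simp
    also have "\<dots> = (\<Sum>i\<in>W. \<Sum>v<m. c (?r v i))" by (rule sum.swap)
    also have "\<dots> = int (card W) * C"
      using sum.reindex_bij_betw[OF bij_betw_Suc_add_mod[OF m], of c] by (simp add: C_def)
    finally show ?thesis using C by simp
  qed
  then have "card W = nat (int m * k div C)" if "maximal_independent_set ?G W" for W
    using that by (metis nat_int)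
  then show ?R by blast
next
  assume ?R
  then show "levelable ?G"
    unfolding levelable_def by (intro exI[of _ "\<lambda>_. 1"]) auto
qed

section \<open>The graphs \<open>C\<^bsub>2n\<^esub>(2,n)\<close>\<close>

text \<open>Stated additively to avoid truncated subtraction and absolute values. The last two
  disjuncts are the wrapped form of distance 2; distance \<open>n\<close> is its own complement in
  \<open>2*n\<close>.\<close>

definition adj :: "nat \<Rightarrow> nat \<Rightarrow> nat \<Rightarrow> bool" where
  "adj n v w \<longleftrightarrow> v \<noteq> w \<and>
    (v = w + 2 \<or> w = v + 2 \<or> v = w + n \<or> w = v + n \<or> v + 2 = w + 2*n \<or> w + 2 = v + 2*n)"

lemma edge_circulant_2_n_iff:
  assumes "i \<in> {1..2*n}" "j \<in> {1..2*n}" "n > 0"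
  shows "{i, j} \<in> edges (circulant_graph (2*n) {2, n}) \<longleftrightarrow> adj n i j"
proof (cases "i = j")
  case True
  then show ?thesis by (auto simp: circulant_graph_def doubleton_eq_iff adj_def)
next
  case False
  have "nat \<bar>int i - int j\<bar> = (if i \<le> j then j - i else i - j)" by auto
  then show ?thesis
    unfolding edge_circulant_graph_iff[OF assms(1,2) False] adj_def using assms False by auto
qed

lemma maximal_independent_set_circulant_2_n_iff:
  assumes "n > 0"
  shows "maximal_independent_set (circulant_graph (2*n) {2, n}) W \<longleftrightarrow>
    W \<subseteq> {1..2*n} \<and> (\<forall>v\<in>{1..2*n}. v \<in> W \<longleftrightarrow> (\<forall>w\<in>W. \<not> adj n v w))"
  unfolding maximal_independent_set_iff[OF finite_simple_graph_circulant_graph]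
    vertices_circulant_graph
proof (intro conj_cong refl ball_cong)
  fix v assume "W \<subseteq> {1..2*n}" "v \<in> {1..2*n}"
  then have "{v, w} \<in> edges (circulant_graph (2*n) {2, n}) \<longleftrightarrow> adj n v w" if "w \<in> W" for w
    using that edge_circulant_2_n_iff assms by blast
  then show "(v \<in> W \<longleftrightarrow> (\<forall>w\<in>W. {v, w} \<notin> edges (circulant_graph (2*n) {2, n}))) \<longleftrightarrow>
    (v \<in> W \<longleftrightarrow> (\<forall>w\<in>W. \<not> adj n v w))"
    by simp
qed

text \<open>Adjacency is symmetric and \<open>ind\<close> ranges over ordered pairs, so
  \<open>ind\<close> lists only one of each two mirrored disjuncts of \<open>adj\<close>.\<close>

lemma maximal_independent_set_circulant_2_nI:
  assumes "n > 0" "W \<subseteq> {1..2*n}"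
    and ind: "\<And>i j. i \<in> W \<Longrightarrow> j \<in> W \<Longrightarrow> j \<noteq> i + 2 \<and> j \<noteq> i + n \<and> j + 2 \<noteq> i + 2*n"
    and dom: "\<And>v. v \<in> {1..2*n} \<Longrightarrow> v \<notin> W \<Longrightarrow> \<exists>w\<in>W. adj n v w"
  shows "maximal_independent_set (circulant_graph (2*n) {2, n}) W"
proof -
  have "\<not> adj n v w" if "v \<in> W" "w \<in> W" for v w
    using ind[OF that] ind[OF that(2,1)] by (simp add: adj_def)
  then show ?thesis
    unfolding maximal_independent_set_circulant_2_n_iff[OF assms(1)] using assms(2) dom by blast
qed

section \<open>Two maximal independent sets of different sizes for n \<ge> 7\<close>

text \<open>With rows \<open>T k = 2k\<close> and \<open>B k = 2k + n\<close> (modulo \<open>2n\<close>), this is \<open>B 1, T 2, B 3, \<dots>, T (n - 1)\<close>,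
  skipping column \<open>0\<close>.\<close>

definition long_set :: "nat \<Rightarrow> nat set" where
  "long_set n = {v \<in> {1..2*n}. \<exists>k. v = 4*k \<or> v = n + 2 + 4*k \<or> v + 4 + 4*k = n}"

text \<open>Skips the columns \<open>0\<close>, \<open>2\<close> and \<open>4\<close>: the entries \<open>T 2, B 3, T 4\<close> are replaced by \<open>T 3\<close>.\<close>

definition short_set :: "nat \<Rightarrow> nat set" where
  "short_set n = insert 6 (long_set n - {4, 8, n + 6})"

text \<open>As \<open>n\<close> is odd, parity tells the rows apart: even members are
  \<open>4*k\<close>, odd ones have one of the other two forms. Each conflict then violates the
  bounds or equates numbers that are 0 and 2 modulo 4; across the wrap-around this uses that
  \<open>2*n\<close> is 2 modulo 4.\<close>

lemma long_set_independent:
  assumes n: "odd n" and ij: "i \<in> long_set n" "j \<in> long_set n"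
  shows "j \<noteq> i + 2 \<and> j \<noteq> i + n \<and> j + 2 \<noteq> i + 2*n"
proof (intro conjI notI)
  obtain k where i: "1 \<le> i" "i \<le> 2*n"
    and k: "i = 4*k \<or> i = n + 2 + 4*k \<or> i + 4 + 4*k = n"
    using ij(1) by (auto simp: long_set_def)
  obtain l where j: "1 \<le> j" "j \<le> 2*n"
    and l: "j = 4*l \<or> j = n + 2 + 4*l \<or> j + 4 + 4*l = n"
    using ij(2) by (auto simp: long_set_def)
  obtain p where p: "n = 2*p + 1" using n by (elim oddE)
  have e: "4*a = 4*b + 2 \<Longrightarrow> False" for a b :: nat by presburger
  have k: "if even i then i = 4*k else i = n + 2 + 4*k \<or> i + 4 + 4*k = n"
    using k n by auto
  have l: "if even j then j = 4*l else j = n + 2 + 4*l \<or> j + 4 + 4*l = n"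
    using l n by auto
  {
    assume h: "j = i + 2"
    then have parity: "even j \<longleftrightarrow> even i" by simp
    show False
    proof (cases "even i")
      case True
      with parity k l h e[of l k] show False by simp
    next
      case False
      with parity k l have "i = n + 2 + 4*k \<or> i + 4 + 4*k = n" "j = n + 2 + 4*l \<or> j + 4 + 4*l = n"
        by simp_all
      then have "4*l = 4*k + 2 \<or> 4*k = 4*l + 2"
        using h i j by linarith
      then show False using e by blast
    qed
  next
    assume h: "j = i + n"
    then have parity: "even j \<longleftrightarrow> odd i" using n by simp
    show False
    proof (cases "even i")
      case True
      with parity k l have "i = 4*k" "j = n + 2 + 4*l \<or> j + 4 + 4*l = n" by simp_all
      then have "4*k = 4*l + 2" using h j i by linarith
      then show False by (rule e)
    next
      case False
      with parity k l have "i = n + 2 + 4*k \<or> i + 4 + 4*k = n" "j = 4*l" by simp_all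
      then have "i + 4 + 4*k = n" using h j by auto
      then have "4*(k + l + 1) = 4*p + 2" using h p \<open>j = 4*l\<close> by simp
      then show False by (rule e)
    qed
  next
    assume h: "j + 2 = i + 2*n"
    then have "even (j + 2) = even (i + 2*n)" by (rule arg_cong)
    then have parity: "even j \<longleftrightarrow> even i" by simp
    show False
    proof (cases "even i")
      case True
      with k i have "i \<ge> 4" by simp
      then show False using h j by linarith
    next
      case False
      with parity k l have "i = n + 2 + 4*k \<or> i + 4 + 4*k = n" "j = n + 2 + 4*l \<or> j + 4 + 4*l = n"
        by simp_all
      then have "i + 4 + 4*k = n" "j = n + 2 + 4*l" using h i j by auto
      then have "4*(k + l + 2) = 4*p + 2" using h p by simp
      then show False by (rule e)
    qed
  }
qed

text \<open>Even numbers are measured from 0 and odd ones from \<open>n\<close>, on either side.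
  Three of the six classes make up \<open>long_set\<close>, the other three its complement.\<close>

lemma mod_4_cases:
  fixes n v :: nat
  assumes n: "odd n"
  shows "\<exists>k. v = 4*k \<or> v = 4*k + 2 \<or> v = n + 4*k \<or> v = n + 2 + 4*k \<or> v + 2 + 4*k = n \<or>
    v + 4 + 4*k = n"
proof -
  consider "even v" | "even (v - n)" "n \<le> v" | "even (n - v)" "v < n"
    using n by (cases "n \<le> v") auto
  then show ?thesis
  proof cases
    case 1
    then obtain u where "v = 2*u" by (elim evenE)
    then show ?thesis by (cases "even u") (auto elim!: evenE oddE)
  next
    case 2
    then obtain u where "v - n = 2*u" by (elim evenE)
    with 2 have "v = n + 2*u" by simp
    then show ?thesis by (cases "even u") (auto elim!: evenE oddE)
  next
    case 3
    then obtain u where "n - v = 2*u" by (elim evenE)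
    with 3 have "v + 2*u = n" "u > 0" by simp_all
    moreover obtain l where "u = 2*l + 2 \<or> u = 2*l + 1"
    proof (cases "even u")
      case True
      then obtain m where "u = 2*m" by (elim evenE)
      with \<open>u > 0\<close> show ?thesis by (intro that[of "m - 1"]) auto
    qed (auto elim!: oddE intro: that)
    ultimately show ?thesis by auto
  qed
qed

text \<open>Every vertex outside has a neighbour inside along its own row, so no edge of length
  \<open>n\<close> is needed; the vertices are treated by their class modulo 4.\<close>

lemma long_set_dominating:
  assumes n: "odd n" "n > 1" and v: "v \<in> {1..2*n}" "v \<notin> long_set n"
  shows "\<exists>w\<in>long_set n. v = w + 2 \<or> w = v + 2 \<or> w + 2 = v + 2*n"
proof -
  obtain k where "v = 4*k + 2 \<or> v = n + 4*k \<or> v + 2 + 4*k = n"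
    using mod_4_cases[OF n(1), of v] v by (auto simp: long_set_def)
  then consider (a) "v = 4*k + 2" | (b) "v = n + 4*k" | (c) "v + 2 + 4*k = n"
    by blast
  then show ?thesis
  proof cases
    case a
    show ?thesis
    proof (cases "v = 2*n")
      \<comment> \<open>This is the skipped vertex \<open>T 0\<close>. Its successor 2 is not a
        member, so the predecessor is taken.\<close>
      case True
      with a n have "4*k \<in> long_set n" by (auto simp: long_set_def)
      with a show ?thesis by blast
    next
      case False
      have "even v" using a by simp
      with False v(1) have "v + 2 \<le> 2*n" by (auto elim!: evenE)
      with a have "v + 2 \<in> long_set n" by (auto simp: long_set_def intro!: exI[of _ "Suc k"])
      then show ?thesis by blast
    qed
  next
    case b
    show ?thesis
    proof (cases k)
      \<comment> \<open>Here \<open>v = n\<close> is \<open>B 0\<close>, the other vertex of the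
        skipped column, with neighbour \<open>B 1\<close>.\<close>
      case 0
      with b n have "v + 2 \<in> long_set n" by (auto simp: long_set_def intro!: exI[of _ 0])
      then show ?thesis by blast
    next
      case (Suc l)
      with b v(1) have "n + 2 + 4*l \<in> long_set n" by (auto simp: long_set_def)
      with b Suc show ?thesis by (intro bexI[of _ "n + 2 + 4*l"]) auto
    qed
  next
    case c
    show ?thesis
    proof (cases "v = 1")
      \<comment> \<open>The predecessor of 1 wraps to \<open>2*n - 1\<close>, which is
        \<open>n + 2 + 4*k\<close> because \<open>n = 4*k + 3\<close>.\<close>
      case True
      with c have "n + 2 + 4*k \<in> long_set n" by (auto simp: long_set_def)
      with c True show ?thesis by (intro bexI[of _ "n + 2 + 4*k"]) auto
    next
      case False
      have "odd v" using c n(1) by auto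
      with False have "v \<ge> 3" by (cases "v = 2") (auto elim!: oddE)
      with c have "v - 2 \<in> long_set n" by (auto simp: long_set_def intro!: exI[of _ k])
      with \<open>v \<ge> 3\<close> show ?thesis by (intro bexI[of _ "v - 2"]) auto
    qed
  qed
qed

lemma maximal_independent_set_long_set:
  assumes n: "n \<ge> 7" "odd n"
  shows "maximal_independent_set (circulant_graph (2*n) {2, n}) (long_set n)"
proof (rule maximal_independent_set_circulant_2_nI)
  have n1: "n > 1" using n by simp
  fix v assume v: "v \<in> {1..2*n}" "v \<notin> long_set n"
  then obtain w where "w \<in> long_set n" "v = w + 2 \<or> w = v + 2 \<or> w + 2 = v + 2*n"
    using long_set_dominating[OF n(2) n1] by blast
  then show "\<exists>w\<in>long_set n. adj n v w"
    using n by (intro bexI[of _ w]) (auto simp: adj_def)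
next
  show "j \<noteq> i + 2 \<and> j \<noteq> i + n \<and> j + 2 \<noteq> i + 2*n" if "i \<in> long_set n" "j \<in> long_set n" for i j
    using long_set_independent[OF n(2) that] .
qed (use n in \<open>auto simp: long_set_def\<close>)

text \<open>The removed 4, 8 and \<open>n + 6\<close> are exactly the neighbours of 6. Hence 6
  conflicts with nothing and dominates them; what remains is to find new neighbours for vertices
  that relied on a removed one.\<close>

lemma maximal_independent_set_short_set:
  assumes n: "n \<ge> 7" "odd n"
  shows "maximal_independent_set (circulant_graph (2*n) {2, n}) (short_set n)"
proof (rule maximal_independent_set_circulant_2_nI)
  fix i j assume ij: "i \<in> short_set n" "j \<in> short_set n"
  show "j \<noteq> i + 2 \<and> j \<noteq> i + n \<and> j + 2 \<noteq> i + 2*n"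
  proof (cases "i = 6 \<or> j = 6")
    case True
    have "i \<le> 2*n" "j \<le> 2*n" "i \<notin> {0, 4, 8, n + 6}" "j \<notin> {0, 4, 8, n + 6}"
      using ij n by (auto simp: short_set_def long_set_def)
    with True n show ?thesis by auto
  next
    case False
    with ij n show ?thesis
      using long_set_independent[of n i j] by (simp add: short_set_def)
  qed
next
  have n1: "n > 1" using n by simp
  fix v assume v: "v \<in> {1..2*n}" "v \<notin> short_set n"
  have 6: "6 \<in> short_set n" by (simp add: short_set_def)
  have *: "w \<in> short_set n" if "w \<in> long_set n" "w \<notin> {4, 8, n + 6}" for w
    using that by (simp add: short_set_def)
  show "\<exists>w\<in>short_set n. adj n v w"
  proof (cases "v \<in> long_set n")
    case True
    then have "v \<in> {4, 8, n + 6}" using v * by blast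
    with 6 n show ?thesis by (intro bexI[of _ 6]) (auto simp: adj_def)
  next
    case False
    then obtain w where w: "w \<in> long_set n" "v = w + 2 \<or> w = v + 2 \<or> w + 2 = v + 2*n"
      using long_set_dominating[OF n(2) n1 v(1)] by blast
    show ?thesis
    proof (cases "w \<in> short_set n")
      case True
      with w n show ?thesis by (intro bexI[of _ w]) (auto simp: adj_def)
    next
      case notin: False
      have n2: "n + 2 \<in> short_set n"
        using n by (intro *) (auto simp: long_set_def)
      have w': "w = 4 \<or> w = 8 \<or> w = n + 6" using notin w(1) * by blast
      have v': "v \<noteq> 6" "v \<ge> 1" using v 6 by auto
      \<comment> \<open>These are \<open>T 1\<close>, \<open>T 5\<close>, \<open>B 2\<close> and
        \<open>B 4\<close>, the row neighbours of removed vertices other than 6; for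
        \<open>n = 7\<close> the vertex \<open>B 4\<close> wraps to 1.\<close>
      consider "v = 2" | "v = 10" | "v = n + 4" | "v = n + 8" | "v = 1" "n = 7"
        using w' w(2) v' n(1) by (elim disjE) auto
      then show ?thesis
      proof cases
        assume "v = 10"
        moreover have "12 \<in> short_set n"
          using n by (intro *) (auto simp: long_set_def intro: exI[of _ 3])
        ultimately show ?thesis using n by (intro bexI[of _ 12]) (auto simp: adj_def)
      next
        \<comment> \<open>The new neighbour is \<open>B 5\<close>, that is \<open>n + 10\<close>
          modulo \<open>2*n\<close>: 3 for \<open>n = 7\<close> and 1 for
          \<open>n = 9\<close>.\<close>
        assume v8: "v = n + 8"
        have "n \<noteq> 8" using n(2) by auto
        then consider "n = 7" | "n = 9" | "n \<ge> 10" using n(1) by linarith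
        then show ?thesis
        proof cases
          assume "n = 7"
          moreover from this have "3 \<in> short_set n"
            by (intro *) (auto simp: long_set_def)
          ultimately show ?thesis using v v8 by (intro bexI[of _ 3]) (auto simp: adj_def)
        next
          assume "n = 9"
          moreover from this have "1 \<in> short_set n"
            by (intro *) (auto simp: long_set_def)
          ultimately show ?thesis using v v8 by (intro bexI[of _ 1]) (auto simp: adj_def)
        next
          assume "n \<ge> 10"
          then have "n + 10 \<in> short_set n"
            using n by (intro *) (auto simp: long_set_def intro: exI[of _ 2])
          with v8 n show ?thesis by (intro bexI[of _ "n + 10"]) (auto simp: adj_def)
        qed
      next
        assume "v = 1" "n = 7"
        moreover from this have "3 \<in> short_set n"
            by (intro *) (auto simp: long_set_def)
        ultimately show ?thesis by (intro bexI[of _ 3]) (auto simp: adj_def)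
      \<comment> \<open>The remaining vertices 2 and \<open>n + 4\<close> are both adjacent to
        \<open>n + 2\<close>.\<close>
      qed (use n n2 in \<open>auto simp: adj_def intro!: bexI[of _ "n + 2"]\<close>)
    qed
  qed
qed (use n in \<open>auto simp: short_set_def long_set_def\<close>)

lemma card_short_set:
  assumes n: "n \<ge> 7" "odd n"
  shows "card (short_set n) < card (long_set n)"
proof -
  have fin: "finite (long_set n)" by (simp add: long_set_def)
  have sub: "{4, 8, n + 6} \<subseteq> long_set n"
    using n by (auto simp: long_set_def intro: exI[of _ 1] exI[of _ 2])
  have "card {4, 8, n + 6} = 3" using n by auto
  then have "card (long_set n - {4, 8, n + 6}) = card (long_set n) - 3" "3 \<le> card (long_set n)"
    using card_Diff_subset[OF _ sub] card_mono[OF fin sub] by auto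
  moreover have "card (short_set n) \<le> Suc (card (long_set n - {4, 8, n + 6}))"
    unfolding short_set_def by (rule card_insert_le_m1) auto
  ultimately show ?thesis by linarith
qed

section \<open>The cases n = 3 and n = 5\<close>

lemma card_eq_sum_of_bool:
  assumes "finite A" "W \<subseteq> A"
  shows "card W = (\<Sum>v\<in>A. of_bool (v \<in> W))"
  using assms by (simp add: Int_absorb1 Collect_mem_eq)

text \<open>Each \<open>p\<close> with index v stands for membership of v, and each premise says
  that v is in the set iff none of its three neighbours is. Explicit quantifiers let
  \<open>all_bool_eq\<close> enumerate all assignments.\<close>

lemma prism_3_bools:
  "\<forall>p1 p2 p3 p4 p5 p6.
    p1 = (\<not> p3 \<and> \<not> p4 \<and> \<not> p5) \<longrightarrow> p2 = (\<not> p4 \<and> \<not> p5 \<and> \<not> p6) \<longrightarrow>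
    p3 = (\<not> p1 \<and> \<not> p5 \<and> \<not> p6) \<longrightarrow> p4 = (\<not> p1 \<and> \<not> p2 \<and> \<not> p6) \<longrightarrow>
    p5 = (\<not> p1 \<and> \<not> p2 \<and> \<not> p3) \<longrightarrow> p6 = (\<not> p2 \<and> \<not> p3 \<and> \<not> p4) \<longrightarrow>
    of_bool p1 + of_bool p2 + of_bool p3 + of_bool p4 + of_bool p5 + of_bool p6 = (2::nat)"
  by (simp add: all_bool_eq)

lemma card_maximal_independent_set_3:
  assumes W: "maximal_independent_set (circulant_graph 6 {2, 3}) W"
  shows "card W = 2"
proof -
  have V: "{1..6} = {1, 2, 3, 4, 5, 6::nat}"
    by auto
  have WV: "W \<subseteq> {1..6}"
    and "\<And>v. v \<in> {1..6} \<Longrightarrow> v \<in> W \<longleftrightarrow> (\<forall>w\<in>W. \<not> adj 3 v w)"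
    using W maximal_independent_set_circulant_2_n_iff[of 3 W] by auto
  \<comment> \<open>Ranging over all vertices instead of \<open>W\<close> gives a finite
    conjunction, which \<open>adj_def\<close> reduces to the premises of
    \<open>prism_3_bools\<close>.\<close>
  then have "v \<in> W \<longleftrightarrow> (\<forall>w\<in>{1..6}. adj 3 v w \<longrightarrow> w \<notin> W)" if "v \<in> {1..6}" for v
    using that by blast
  note mem = this[unfolded V]
  have "card W = of_bool (1 \<in> W) + of_bool (2 \<in> W) + of_bool (3 \<in> W) + of_bool (4 \<in> W) + of_bool (5 \<in> W) +
    of_bool (6 \<in> W)"
    unfolding card_eq_sum_of_bool[OF finite_atLeastAtMost WV] V by (simp del: sum_of_bool_eq)
  also have "\<dots> = 2"
    by (rule prism_3_bools[rule_format]; subst mem, simp, simp add: adj_def)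
  finally show ?thesis .
qed

lemma prism_5_bools:
  "\<forall>p1 p2 p3 p4 p5 p6 p7 p8 p9 p10.
    p1 = (\<not> p3 \<and> \<not> p6 \<and> \<not> p9) \<longrightarrow> p2 = (\<not> p4 \<and> \<not> p7 \<and> \<not> p10) \<longrightarrow>
    p3 = (\<not> p1 \<and> \<not> p5 \<and> \<not> p8) \<longrightarrow> p4 = (\<not> p2 \<and> \<not> p6 \<and> \<not> p9) \<longrightarrow>
    p5 = (\<not> p3 \<and> \<not> p7 \<and> \<not> p10) \<longrightarrow> p6 = (\<not> p1 \<and> \<not> p4 \<and> \<not> p8) \<longrightarrow>
    p7 = (\<not> p2 \<and> \<not> p5 \<and> \<not> p9) \<longrightarrow> p8 = (\<not> p3 \<and> \<not> p6 \<and> \<not> p10) \<longrightarrow>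
    p9 = (\<not> p1 \<and> \<not> p4 \<and> \<not> p7) \<longrightarrow> p10 = (\<not> p2 \<and> \<not> p5 \<and> \<not> p8) \<longrightarrow>
    of_bool p1 + of_bool p2 + of_bool p3 + of_bool p4 + of_bool p5 + of_bool p6 +
    of_bool p7 + of_bool p8 + of_bool p9 + of_bool p10 = (4::nat)"
  by (simp add: all_bool_eq)

lemma card_maximal_independent_set_5:
  assumes W: "maximal_independent_set (circulant_graph 10 {2, 5}) W"
  shows "card W = 4"
proof -
  have V: "{1..10} = {1, 2, 3, 4, 5, 6, 7, 8, 9, 10::nat}"
    by (simp add: atLeastAtMost_insertL[symmetric] numeral_eq_Suc)
  have WV: "W \<subseteq> {1..10}"
    and "\<And>v. v \<in> {1..10} \<Longrightarrow> v \<in> W \<longleftrightarrow> (\<forall>w\<in>W. \<not> adj 5 v w)"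
    using W maximal_independent_set_circulant_2_n_iff[of 5 W] by auto
  then have "v \<in> W \<longleftrightarrow> (\<forall>w\<in>{1..10}. adj 5 v w \<longrightarrow> w \<notin> W)" if "v \<in> {1..10}" for v
    using that by blast
  note mem = this[unfolded V]
  have "card W = of_bool (1 \<in> W) + of_bool (2 \<in> W) + of_bool (3 \<in> W) + of_bool (4 \<in> W) + of_bool (5 \<in> W) +
    of_bool (6 \<in> W) + of_bool (7 \<in> W) + of_bool (8 \<in> W) + of_bool (9 \<in> W) + of_bool (10 \<in> W)"
    unfolding card_eq_sum_of_bool[OF finite_atLeastAtMost WV] V by (simp del: sum_of_bool_eq)
  also have "\<dots> = 4"
    by (rule prism_5_bools[rule_format]; subst mem, simp, simp add: adj_def)
  finally show ?thesis .
qed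

theorem theorem6p5:
  fixes n :: nat
  assumes "n \<ge> 3" and "odd n"
  shows "levelable (circulant_graph (2 * n) {2, n}) \<longleftrightarrow> n \<in> {3, 5}"
proof
  assume L: "levelable (circulant_graph (2 * n) {2, n})"
  have "\<not> n \<ge> 7"
  proof
    assume "n \<ge> 7"
    \<comment> \<open>Levelability would force \<open>long_set n\<close> and
      \<open>short_set n\<close> to have equal size.\<close>
    with L show False
      using levelable_circulant_graph_iff[of "2*n" "{2, n}"] card_short_set[OF _ assms(2)]
        maximal_independent_set_long_set[OF _ assms(2)]
        maximal_independent_set_short_set[OF _ assms(2)] by fastforce
  qed
  with assms show "n \<in> {3, 5}" by (simp, presburger)
next
  assume "n \<in> {3, 5}"
  then show "levelable (circulant_graph (2 * n) {2, n})"
    using levelable_circulant_graph_iff[of "2*n" "{2, n}"]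
      card_maximal_independent_set_3 card_maximal_independent_set_5 by auto
qed

end
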